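(* Let $K\subset\mathbb{R}^p$ be a convex cone, let $\bar A$ be a $p\times p$ positive semidefinite matrix with largest eigenvalue $\lambda$ and a first principal eigenvector $\bar x\in K\cap\mathbb{S}^{p-1}$, and let $A=\bar A+E$ be positive semidefinite. Consider the cone projected power iteration with initialization $v_0$, $$v_{t}=\frac{\Pi_K A v_{t-1}}{\|\Pi_K A v_{t-1}\|},\qquad t\ge 1,$$ with stopping criterion $\Delta$. Assume that $v_0^\top A v_0>0$. Then, to get $\|v_t-v_{t-1}\|\le\Delta$, at most $$\left\lceil\frac{\log\left[\frac{\lambda+\|E\|_K}{v_0^\top A v_0}\right]}{\log(1+\Delta^2)}\right\rceil$$ iterations are needed.
   Context: $\|\cdot\|$ is the Euclidean norm and $\mathbb{S}^{p-1}$ the unit sphere of $\mathbb{R}^p$. $\Pi_K v=\arg\min_{x\in K}\|v-x\|$ is the Euclidean projection onto $K$. The cone-restricted operator norm is $\|E\|_K=\sup_{x,y\in K\cap\mathbb{S}^{p-1}}|x^\top E y|$. The iteration is run until two consecutive iterates are within distance $\Delta$ of each other.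
   Formalization: The initialization v_0 is taken to be a unit vector in K and Δ > 0 (otherwise the bound can be negative, fail or be undefined), and the bound is replaced by the maximum of 1 and the stated ceiling, since the ceiling is 0 when v_0^T A v_0 = λ + ‖E‖_K while one iteration is needed. *)

theory Defs
  imports "HOL-Analysis.Analysis"
begin

definition psd :: "real^'n^'n \<Rightarrow> bool" where
  "psd M \<longleftrightarrow> transpose M = M \<and> (\<forall>x. 0 \<le> x \<bullet> (M *v x))"

definition is_eigenpair :: "real^'n^'n \<Rightarrow> real \<Rightarrow> real^'n \<Rightarrow> bool" where
  "is_eigenpair M l x \<longleftrightarrow> x \<noteq> 0 \<and> M *v x = l *\<^sub>R x"

definition is_largest_eigenvalue :: "real^'n^'n \<Rightarrow> real \<Rightarrow> bool" where
  "is_largest_eigenvalue M l \<longleftrightarrow>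
     (\<exists>x. is_eigenpair M l x) \<and> (\<forall>m x. is_eigenpair M m x \<longrightarrow> m \<le> l)"

definition cone_opnorm :: "(real^'n) set \<Rightarrow> real^'n^'n \<Rightarrow> real" where
  "cone_opnorm K M = Sup {\<bar>x \<bullet> (M *v y)\<bar> | x y. x \<in> K \<inter> sphere 0 1 \<and> y \<in> K \<inter> sphere 0 1}"

(* A relation rather than closest_point, because K is not assumed closed:
   closest_point K u is an unspecified vector when the minimum is not attained. *)
definition is_projection :: "'a::real_normed_vector set \<Rightarrow> 'a \<Rightarrow> 'a \<Rightarrow> bool" where
  "is_projection K u w \<longleftrightarrow> is_arg_min (\<lambda>x. norm (u - x)) (\<lambda>x. x \<in> K) w"

lemma is_projection_iff_closest_point:
  fixes K :: "'a::{real_inner,heine_borel} set"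
  assumes "convex K" "closed K" "K \<noteq> {}"
  shows "is_projection K u w \<longleftrightarrow> w = closest_point K u"
proof -
  have "is_projection K u w \<longleftrightarrow> w \<in> K \<and> (\<forall>y\<in>K. dist u w \<le> dist u y)"
    by (auto simp: is_projection_def is_arg_min_def dist_norm not_less)
  then show ?thesis
    using closest_point_unique[OF assms(1,2)] closest_point_exists[OF assms(2,3)] by blast
qed

definition cone_power_iteration :: "(real^'n) set \<Rightarrow> real^'n^'n \<Rightarrow> (nat \<Rightarrow> real^'n) \<Rightarrow> bool" where
  "cone_power_iteration K A v \<longleftrightarrow>
     (\<forall>t\<ge>1. \<exists>w. is_projection K (A *v v (t - 1)) w \<and> v t = (1 / norm w) *\<^sub>R w)"

end

theory Submission
  imports Defs
begin

text \<open>The Rayleigh quotient \<open>q t = v t \<bullet> (A *v v t)\<close> is bounded by \<open>lam + cone_opnorm K E\<close>, and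
  each step of length \<open>d\<close> multiplies it by at least \<open>1 + d\<^sup>2\<close>. Indeed, with \<open>w\<close> the projection of
  \<open>A *v v t\<close> and \<open>c = v (t + 1) \<bullet> v t = 1 - d\<^sup>2 / 2\<close>, the cone projection inequalities give
  \<open>q t \<le> norm w * c\<close> and \<open>norm w = v (t + 1) \<bullet> (A *v v t)\<close>, so Cauchy-Schwarz for the form of \<open>A\<close>
  yields \<open>q t \<le> c\<^sup>2 * q (t + 1)\<close>. Finally \<open>(1 + d\<^sup>2) * c\<^sup>2 \<le> 1\<close> for \<open>c > 0\<close>.\<close>

lemma inner_symmetric_matrix_commute:
  fixes M :: "real^'n^'n"
  assumes "transpose M = M"
  shows "x \<bullet> (M *v y) = y \<bullet> (M *v x)"
  using assms by (metis dot_lmul_matrix inner_commute transpose_matrix_vector)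

text \<open>The form is nonnegative on every combination
  \<open>s *\<^sub>R x - t *\<^sub>R y\<close>, and suitable coefficients give the inequality. Since
  the form may be degenerate, the case where it vanishes at \<open>y\<close> is separate.\<close>

lemma psd_Cauchy_Schwarz:
  fixes M :: "real^'n^'n"
  assumes "psd M"
  shows "(x \<bullet> (M *v y))\<^sup>2 \<le> (x \<bullet> (M *v x)) * (y \<bullet> (M *v y))"
proof -
  have sym: "transpose M = M" and nonneg: "\<And>z. 0 \<le> z \<bullet> (M *v z)"
    using assms by (auto simp: psd_def)
  define a b c where "a = x \<bullet> (M *v x)" and "b = x \<bullet> (M *v y)" and "c = y \<bullet> (M *v y)"
  have quad: "0 \<le> s\<^sup>2 * a - 2 * s * t * b + t\<^sup>2 * c" for s t
  proof -
    have "(s *\<^sub>R x - t *\<^sub>R y) \<bullet> (M *v (s *\<^sub>R x - t *\<^sub>R y)) = s\<^sup>2 * a - 2 * s * t * b + t\<^sup>2 * c"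
      using inner_symmetric_matrix_commute[OF sym, of y x]
      by (simp add: a_def b_def c_def matrix_vector_mult_diff_distrib matrix_vector_mult_scaleR
          inner_diff_left inner_diff_right power2_eq_square algebra_simps)
    then show ?thesis using nonneg by metis
  qed
  have "b\<^sup>2 \<le> a * c"
  proof (cases "c = 0")
    case True
    have "b = 0"
    proof (rule ccontr)
      assume "b \<noteq> 0"
      then show False
        \<comment> \<open>With \<open>c = 0\<close> the quadratic is linear in \<open>t\<close>;
          this \<open>t\<close> makes its value \<open>a - (a + 1) = -1\<close>.\<close>
        using quad[of 1 "(a + 1) / (2 * b)"] True by simp
    qed
    then show ?thesis using True by simp
  next
    case False
    then have "c > 0" using nonneg[of y] by (simp add: c_def)
    moreover have "0 \<le> c * (a * c - b\<^sup>2)"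
      using quad[of c b] by (simp add: power2_eq_square algebra_simps)
    ultimately show ?thesis by (simp add: zero_le_mult_iff)
  qed
  then show ?thesis by (simp add: a_def b_def c_def)
qed

lemma continuous_on_matrix_vector_mult:
  fixes M :: "real^'n^'m"
  shows "continuous_on S (\<lambda>x. M *v x)"
  by (intro linear_continuous_on) (simp add: linear_conv_bounded_linear[symmetric])

text \<open>By compactness the Rayleigh quotient attains its maximum \<open>mu\<close> on the sphere
  at some \<open>u\<close>. It suffices that \<open>mu\<close> is an eigenvalue, which follows by
  applying Cauchy-Schwarz to the psd matrix \<open>mat mu - M\<close>.\<close>

lemma rayleigh_le_largest_eigenvalue:
  fixes M :: "real^'n^'n"
  assumes sym: "transpose M = M" and lam: "is_largest_eigenvalue M lam" and "norm x = 1"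
  shows "x \<bullet> (M *v x) \<le> lam"
proof -
  have "continuous_on (sphere 0 1) (\<lambda>x. x \<bullet> (M *v x))"
    by (intro continuous_intros continuous_on_matrix_vector_mult)
  moreover have "sphere (0::real^'n) 1 \<noteq> {}" using \<open>norm x = 1\<close> by auto
  ultimately have "\<exists>u\<in>sphere 0 1. \<forall>y\<in>sphere 0 1. y \<bullet> (M *v y) \<le> u \<bullet> (M *v u)"
    by (intro continuous_attains_sup compact_sphere)
  then obtain u where u: "norm u = 1" and max: "\<And>y. norm y = 1 \<Longrightarrow> y \<bullet> (M *v y) \<le> u \<bullet> (M *v u)"
    by auto
  define mu where "mu = u \<bullet> (M *v u)"
  define B where "B = mat mu - M"
  have B: "B *v y = mu *\<^sub>R y - M *v y" for y
  proof -
    have "mat mu *v y = mu *\<^sub>R y"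
      by (simp add: vec_eq_iff matrix_vector_mult_def mat_def if_distrib if_distribR cong: if_cong)
    then show ?thesis by (simp add: B_def matrix_vector_mult_diff_rdistrib)
  qed
  have "psd B"
    unfolding psd_def
  proof (intro conjI allI)
    have "transpose B = transpose (mat mu) - transpose M"
      by (simp add: B_def transpose_def vec_eq_iff)
    then show "transpose B = B" by (simp add: B_def sym)
    show "0 \<le> y \<bullet> (B *v y)" for y
    proof (cases "y = 0")
      case False
      have "sgn y \<bullet> (M *v sgn y) \<le> mu"
        using max[of "sgn y"] False by (simp add: mu_def norm_sgn)
      then have "(y \<bullet> (M *v y)) / (norm y)\<^sup>2 \<le> mu"
        by (simp add: sgn_div_norm matrix_vector_mult_scaleR power2_eq_square divide_inverse mult_ac)
      then have "y \<bullet> (M *v y) \<le> mu * (y \<bullet> y)"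
        using False by (simp add: divide_le_eq power2_norm_eq_inner)
      then show ?thesis by (simp add: B inner_diff_right)
    qed simp
  qed
  \<comment> \<open>A null vector of a psd form lies in the kernel: Cauchy-Schwarz makes
    \<open>B *v u\<close> orthogonal to every \<open>y\<close>.\<close>
  have "u \<bullet> (B *v u) = 0"
    using u by (simp add: B inner_diff_right mu_def dot_square_norm)
  then have "y \<bullet> (B *v u) = 0" for y
    using psd_Cauchy_Schwarz[OF \<open>psd B\<close>, of y u] by simp
  then have "B *v u = 0" by (metis inner_eq_zero_iff)
  then have "is_eigenpair M mu u" using u by (auto simp: is_eigenpair_def B)
  then have "mu \<le> lam" using lam by (auto simp: is_largest_eigenvalue_def)
  with max[OF \<open>norm x = 1\<close>] show ?thesis by (simp add: mu_def)
qed

lemma abs_inner_le_cone_opnorm: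
  fixes M :: "real^'n^'n"
  assumes "x \<in> K \<inter> sphere 0 1" "y \<in> K \<inter> sphere 0 1"
  shows "\<bar>x \<bullet> (M *v y)\<bar> \<le> cone_opnorm K M"
  unfolding cone_opnorm_def
proof (rule cSup_upper)
  \<comment> \<open>The supremum of a set of reals is an upper bound only if the set is bounded
    above; here the ordinary operator norm bounds it.\<close>
  show "bdd_above {\<bar>x \<bullet> (M *v y)\<bar> | x y. x \<in> K \<inter> sphere 0 1 \<and> y \<in> K \<inter> sphere 0 1}"
  proof (rule bdd_aboveI)
    fix r assume "r \<in> {\<bar>x \<bullet> (M *v y)\<bar> | x y. x \<in> K \<inter> sphere 0 1 \<and> y \<in> K \<inter> sphere 0 1}"
    then obtain x y where r: "r = \<bar>x \<bullet> (M *v y)\<bar>" and xy: "norm x = 1" "norm y = 1" by auto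
    have "r \<le> norm x * norm (M *v y)" unfolding r by (rule Cauchy_Schwarz_ineq2)
    also have "\<dots> \<le> onorm ((*v) M)"
      using onorm[of "(*v) M" y] xy by (simp add: linear_conv_bounded_linear[symmetric])
    finally show "r \<le> onorm ((*v) M)" .
  qed
qed (use assms in blast)

text \<open>Closedness of \<open>K\<close> is avoided by minimizing only over the segment from
  \<open>w\<close> to \<open>y\<close>, which is closed and lies in \<open>K\<close> by
  convexity.\<close>

lemma is_projection_variational:
  fixes K :: "'a::{real_inner,heine_borel} set"
  assumes "convex K" "is_projection K u w" "y \<in> K"
  shows "(u - w) \<bullet> (y - w) \<le> 0"
proof (rule any_closest_point_dot)
  have w: "w \<in> K" "\<And>z. z \<in> K \<Longrightarrow> dist u w \<le> dist u z"
    using assms(2) by (auto simp: is_projection_def is_arg_min_def dist_norm not_less)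
  show "\<forall>z\<in>closed_segment w y. dist u w \<le> dist u z"
    using w closed_segment_subset[OF w(1) assms(3,1)] by blast
qed auto

text \<open>The residual \<open>u - w\<close> is orthogonal to \<open>w\<close> and lies in the
  polar cone of \<open>K\<close>, as in Moreau's decomposition.\<close>

lemma is_projection_cone:
  fixes K :: "'a::euclidean_space set"
  assumes K: "convex_cone K" and w: "is_projection K u w"
  shows "w \<in> K" "u \<bullet> w = (norm w)\<^sup>2" "\<And>y. y \<in> K \<Longrightarrow> u \<bullet> y \<le> w \<bullet> y"
proof -
  have "convex K" and scale: "\<And>c x. x \<in> K \<Longrightarrow> 0 \<le> c \<Longrightarrow> c *\<^sub>R x \<in> K"
    using K by (auto simp: convex_cone_def conic_def)
  note var = is_projection_variational[OF \<open>convex K\<close> w]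
  show "w \<in> K" using w by (simp add: is_projection_def is_arg_min_def)
  \<comment> \<open>The test points \<open>0\<close> and \<open>2 *\<^sub>R w\<close> bound
    \<open>(u - w) \<bullet> w\<close> from below and from above by zero.\<close>
  from var[OF scale[OF this, of 0]] var[OF scale[OF this, of 2]]
  have orth: "(u - w) \<bullet> w = 0" by (simp add: scaleR_2)
  then show "u \<bullet> w = (norm w)\<^sup>2" by (simp add: inner_diff_left power2_norm_eq_inner)
  show "u \<bullet> y \<le> w \<bullet> y" if "y \<in> K" for y
    using var[OF that] orth by (simp add: inner_diff_left inner_diff_right)
qed

text \<open>The first two conclusions, with the positivity implied by the third, restore the
  hypotheses on \<open>x\<close> for \<open>y\<close>, so the step can be iterated.\<close>

lemma cone_power_step:
  fixes A :: "real^'n^'n"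
  assumes K: "convex_cone K" and A: "psd A"
    and x: "x \<in> K" "norm x = 1" "x \<bullet> (A *v x) > 0"
    and w: "is_projection K (A *v x) w" and y: "y = (1 / norm w) *\<^sub>R w"
  shows "y \<in> K" "norm y = 1" "(1 + (norm (y - x))\<^sup>2) * (x \<bullet> (A *v x)) \<le> y \<bullet> (A *v y)"
proof -
  note proj = is_projection_cone[OF K w]
  define q c where "q = x \<bullet> (A *v x)" and "c = y \<bullet> x"
  have "0 < q" using x by (simp add: q_def)
  have q_le: "q \<le> w \<bullet> x" using proj(3)[OF x(1)] by (simp add: q_def inner_commute)
  \<comment> \<open>Positivity of \<open>q\<close> excludes the degenerate case
    \<open>w = 0\<close>, where \<open>1 / 0 = 0\<close> would make \<open>y\<close> zero.\<close>
  then have "w \<noteq> 0" using \<open>0 < q\<close> by auto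
  then have "norm w > 0" by simp
  show "y \<in> K" using K proj(1) by (simp add: y convex_cone_def conic_def)
  show ny: "norm y = 1" using \<open>w \<noteq> 0\<close> by (simp add: y)
  have "q \<le> norm w * c" using q_le \<open>w \<noteq> 0\<close> by (simp add: c_def y)
  then have "q\<^sup>2 \<le> (norm w * c)\<^sup>2" using \<open>0 < q\<close> by (intro power_mono) auto
  also have "\<dots> = c\<^sup>2 * (y \<bullet> (A *v x))\<^sup>2"
    using proj(2) \<open>w \<noteq> 0\<close> by (simp add: y inner_commute power2_eq_square)
  also have "\<dots> \<le> c\<^sup>2 * ((y \<bullet> (A *v y)) * q)"
    unfolding q_def by (intro mult_left_mono psd_Cauchy_Schwarz A) simp
  finally have q_step: "q \<le> c\<^sup>2 * (y \<bullet> (A *v y))"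
    using \<open>0 < q\<close> by (simp add: power2_eq_square)
  have "0 < norm w * c" using \<open>q \<le> norm w * c\<close> \<open>0 < q\<close> by linarith
  then have "0 < c" using \<open>norm w > 0\<close> by (simp add: zero_less_mult_iff)
  have d: "(norm (y - x))\<^sup>2 = 2 - 2 * c"
    using ny x(2) by (simp add: c_def power2_norm_eq_inner inner_diff_left inner_diff_right
        inner_commute norm_eq_1)
  \<comment> \<open>This factors the cubic \<open>1 - (3 - 2 * c) * c\<^sup>2\<close>, which has a
    double root at \<open>c = 1\<close>; \<open>c > 0\<close> settles the sign of the other
    factor.\<close>
  have "(1 + (norm (y - x))\<^sup>2) * c\<^sup>2 = 1 - (1 - c)\<^sup>2 * (1 + 2 * c)"
    unfolding d by (simp add: power2_eq_square algebra_simps)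
  also have "\<dots> \<le> 1" using \<open>0 < c\<close> by simp
  finally have le1: "(1 + (norm (y - x))\<^sup>2) * c\<^sup>2 \<le> 1" .
  have "(1 + (norm (y - x))\<^sup>2) * q \<le> (1 + (norm (y - x))\<^sup>2) * (c\<^sup>2 * (y \<bullet> (A *v y)))"
    by (intro mult_left_mono q_step) simp
  also have "\<dots> = ((1 + (norm (y - x))\<^sup>2) * c\<^sup>2) * (y \<bullet> (A *v y))" by simp
  also have "\<dots> \<le> 1 * (y \<bullet> (A *v y))"
    using A by (intro mult_right_mono le1) (simp add: psd_def)
  finally show "(1 + (norm (y - x))\<^sup>2) * (x \<bullet> (A *v x)) \<le> y \<bullet> (A *v y)" by (simp add: q_def)
qed


theorem proposition4p1:
  fixes K :: "(real^'n) set" and Abar A E :: "real^'n^'n"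
    and lam \<Delta> :: real and xbar :: "real^'n" and v :: "nat \<Rightarrow> real^'n"
  assumes "convex_cone K"
    and "psd Abar"
    and "is_largest_eigenvalue Abar lam"
    and "is_eigenpair Abar lam xbar" and "xbar \<in> K \<inter> sphere 0 1"
    and "A = Abar + E" and "psd A"
    and "v 0 \<in> K \<inter> sphere 0 1"
    and "cone_power_iteration K A v"
    and "v 0 \<bullet> (A *v v 0) > 0"
    and "\<Delta> > 0"
  shows "\<exists>t\<ge>1. norm (v t - v (t - 1)) \<le> \<Delta> \<and>
           int t \<le> max 1 \<lceil>ln ((lam + cone_opnorm K E) / (v 0 \<bullet> (A *v v 0))) / ln (1 + \<Delta>\<^sup>2)\<rceil>"
proof (rule ccontr)
  assume no_stop: "\<not> ?thesis"
  define q where "q t = v t \<bullet> (A *v v t)" for t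
  define X where "X = ln ((lam + cone_opnorm K E) / q 0) / ln (1 + \<Delta>\<^sup>2)"
  \<comment> \<open>The maximum with 1 covers \<open>X = 0\<close>: the stopping test compares two
    iterates, so at least one step is made.\<close>
  define N where "N = nat (max 1 \<lceil>X\<rceil>)"
  have "N \<ge> 1" and N: "int N = max 1 \<lceil>X\<rceil>" by (auto simp: N_def)
  have far: "\<Delta> < norm (v t - v (t - 1))" if "1 \<le> t" "t \<le> N" for t
    using no_stop that N by (force simp: X_def q_def)
  \<comment> \<open>The weak bound starts the induction at \<open>t = 0\<close>. The strict one,
    from \<open>far\<close>, is needed at \<open>t = N\<close>: it yields \<open>N < X\<close>,
    against \<open>N \<ge> X\<close>.\<close>
  have growth: "v t \<in> K \<and> norm (v t) = 1 \<and> (1 + \<Delta>\<^sup>2) ^ t * q 0 \<le> q t \<and> (t \<ge> 1 \<longrightarrow> (1 + \<Delta>\<^sup>2) ^ t * q 0 < q t)"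
    if "t \<le> N" for t
    using that
  proof (induction t)
    case 0
    then show ?case using assms(8) by simp
  next
    case (Suc t)
    then have IH: "v t \<in> K" "norm (v t) = 1" "(1 + \<Delta>\<^sup>2) ^ t * q 0 \<le> q t" by auto
    have "0 < (1 + \<Delta>\<^sup>2) ^ t * q 0"
      using assms(10) by (simp add: q_def add_pos_nonneg)
    with IH(3) have pos: "0 < q t" by linarith
    obtain w where w: "is_projection K (A *v v t) w" "v (Suc t) = (1 / norm w) *\<^sub>R w"
      using assms(9) unfolding cone_power_iteration_def by (metis diff_Suc_1 le_add1 plus_1_eq_Suc)
    note step = cone_power_step[OF assms(1,7) IH(1,2) pos[unfolded q_def] w]
    have "(1 + \<Delta>\<^sup>2) ^ Suc t * q 0 \<le> (1 + \<Delta>\<^sup>2) * q t"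
      using mult_left_mono[OF IH(3), of "1 + \<Delta>\<^sup>2"] by (simp add: mult.assoc)
    also have "\<dots> < (1 + (norm (v (Suc t) - v t))\<^sup>2) * q t"
      using far[of "Suc t"] Suc.prems \<open>\<Delta> > 0\<close> pos by (simp add: power_strict_mono)
    also have "\<dots> \<le> q (Suc t)" using step(3) by (simp add: q_def)
    finally show ?case using step(1,2) by simp
  qed
  have vN: "v N \<in> K \<inter> sphere 0 1" using growth[of N] by simp
  have "q N = v N \<bullet> (Abar *v v N) + v N \<bullet> (E *v v N)"
    by (simp add: q_def assms(6) matrix_vector_mult_add_rdistrib inner_add_right)
  also have "\<dots> \<le> lam + cone_opnorm K E"
    using rayleigh_le_largest_eigenvalue[OF _ assms(3), of "v N"] assms(2) vN
      abs_inner_le_cone_opnorm[OF vN vN, of E] by (simp add: psd_def)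
  finally have "(1 + \<Delta>\<^sup>2) ^ N * q 0 < lam + cone_opnorm K E"
    using growth[of N] \<open>N \<ge> 1\<close> by simp
  then have lt: "(1 + \<Delta>\<^sup>2) ^ N < (lam + cone_opnorm K E) / q 0"
    using assms(10) by (simp add: q_def pos_less_divide_eq)
  have base: "0 < (1 + \<Delta>\<^sup>2) ^ N" by (simp add: add_pos_nonneg)
  have "ln ((1 + \<Delta>\<^sup>2) ^ N) < ln ((lam + cone_opnorm K E) / q 0)"
    using base lt by (simp add: less_trans[OF base lt])
  then have "real N * ln (1 + \<Delta>\<^sup>2) < ln ((lam + cone_opnorm K E) / q 0)"
    by (simp add: ln_realpow add_pos_nonneg)
  moreover have "0 < ln (1 + \<Delta>\<^sup>2)" using \<open>\<Delta> > 0\<close> by (intro ln_gt_zero) simp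
  ultimately have "real N < X"
    by (simp add: X_def pos_less_divide_eq)
  then show False using N by linarith
qed

end
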